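(* Let $G$ and $H$ be finite groups. If $G$ or $H$ has an equal covering, then $G\times H$ has an equal covering.
   Context: A covering of a group $G$ is a collection of proper subgroups of $G$ whose set-theoretic union is $G$. An equal covering of $G$ is a covering of $G$ all of whose members have the same order. *)

theory Defs
  imports "HOL-Algebra.Group"
begin

definition group_covering :: "('a, 'm) monoid_scheme \<Rightarrow> 'a set set \<Rightarrow> bool" where
  "group_covering G \<C> \<longleftrightarrow>
     (\<forall>S\<in>\<C>. subgroup S G \<and> S \<noteq> carrier G) \<and> \<Union>\<C> = carrier G"

(* The order of a subgroup is rendered by card, so this is meaningful for finite G only
   (card is 0 on every infinite set). *)
definition equal_covering :: "('a, 'm) monoid_scheme \<Rightarrow> 'a set set \<Rightarrow> bool" where
  "equal_covering G \<C> \<longleftrightarrow>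
     group_covering G \<C> \<and> (\<forall>S\<in>\<C>. \<forall>T\<in>\<C>. card S = card T)"

end

theory Submission
  imports Defs
begin

text \<open>A covering of one factor is lifted to the product by pairing each member with the whole
  other factor: a covering \<open>\<C>\<close> of \<open>G\<close> gives the sets
  \<open>S \<times> carrier H\<close>, the preimages of the members under the projection to
  \<open>G\<close>. Such preimages are proper subgroups and cover the product. Each has order
  \<open>card S * card (carrier H)\<close>, so equal orders stay equal. A covering of
  \<open>H\<close> is lifted symmetrically.\<close>

lemma group_covering_DirProd_left:
  assumes "group G" and "group H" and "group_covering G \<C>"
  shows "group_covering (G \<times>\<times> H) ((\<lambda>S. S \<times> carrier H) ` \<C>)"
proof -
  \<comment> \<open>Needed to cancel the factor \<open>carrier H\<close>:
    \<open>times_eq_iff\<close> has an extra case for empty products, and properness of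
    \<open>S\<close> must carry over to \<open>S \<times> carrier H\<close>.\<close>
  have ne: "carrier H \<noteq> {}"
    using monoid.one_closed[OF group.is_monoid[OF \<open>group H\<close>]] by blast
  have "subgroup (S \<times> carrier H) (G \<times>\<times> H) \<and> S \<times> carrier H \<noteq> carrier (G \<times>\<times> H)"
    if "S \<in> \<C>" for S
  proof -
    have S: "subgroup S G" "S \<noteq> carrier G"
      using assms(3) that by (auto simp: group_covering_def)
    show ?thesis
      using DirProd_subgroups[OF assms(1) S(1) assms(2) group.subgroup_self[OF assms(2)]] S(2) ne
      by (auto simp: times_eq_iff)
  qed
  \<comment> \<open>The covering condition holds because union distributes over the product with the
    fixed set \<open>carrier H\<close>.\<close>
  then show ?thesis
    using assms(3) by (auto simp: group_covering_def)
qed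

lemma group_covering_DirProd_right:
  assumes "group G" and "group H" and "group_covering H \<D>"
  shows "group_covering (G \<times>\<times> H) ((\<lambda>T. carrier G \<times> T) ` \<D>)"
proof -
  have ne: "carrier G \<noteq> {}"
    using monoid.one_closed[OF group.is_monoid[OF \<open>group G\<close>]] by blast
  have "subgroup (carrier G \<times> T) (G \<times>\<times> H) \<and> carrier G \<times> T \<noteq> carrier (G \<times>\<times> H)"
    if "T \<in> \<D>" for T
  proof -
    have T: "subgroup T H" "T \<noteq> carrier H"
      using assms(3) that by (auto simp: group_covering_def)
    show ?thesis
      using DirProd_subgroups[OF assms(1) group.subgroup_self[OF assms(1)] assms(2) T(1)] T(2) ne
      by (auto simp: times_eq_iff)
  qed
  then show ?thesis
    using assms(3) by (auto simp: group_covering_def)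
qed

lemma equal_covering_DirProd_left:
  assumes "group G" and "group H" and "equal_covering G \<C>"
  shows "equal_covering (G \<times>\<times> H) ((\<lambda>S. S \<times> carrier H) ` \<C>)"
  \<comment> \<open>\<open>ball_simps\<close> moves the quantifiers from the image back to
    \<open>\<C>\<close>; the orders to compare then share the factor
    \<open>card (carrier H)\<close>.\<close>
  unfolding equal_covering_def ball_simps card_cartesian_product
  using assms group_covering_DirProd_left unfolding equal_covering_def by metis

lemma equal_covering_DirProd_right:
  assumes "group G" and "group H" and "equal_covering H \<D>"
  shows "equal_covering (G \<times>\<times> H) ((\<lambda>T. carrier G \<times> T) ` \<D>)"
  unfolding equal_covering_def ball_simps card_cartesian_product
  using assms group_covering_DirProd_right unfolding equal_covering_def by metis

theorem theorem16:
  fixes G :: "('a, 'm) monoid_scheme" and H :: "('b, 'n) monoid_scheme"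
  assumes "group G" and "finite (carrier G)"
    and "group H" and "finite (carrier H)"
    and "(\<exists>\<C>. equal_covering G \<C>) \<or> (\<exists>\<D>. equal_covering H \<D>)"
  shows "\<exists>\<E>. equal_covering (G \<times>\<times> H) \<E>"
  using assms(5) equal_covering_DirProd_left[OF assms(1,3)]
    equal_covering_DirProd_right[OF assms(1,3)] by blast

end
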